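(* Let $(M,g)=(\mathcal{I} \times \mathrm{H}, \varepsilon\, dt^2+\chi_t)$ be an Einstein Heisenberg four-manifold of neutral signature. Assume that $\mathcal{Z}_{t_0}$ is timelike (resp. spacelike, resp. lightlike) for some $t_0 \in \mathcal{I}$. Then $\mathcal{Z}_t$ is timelike (resp. spacelike, resp. lightlike) for all $t \in \mathcal{I}$.
   Context: $\mathrm{H}$ is the three-dimensional Heisenberg group (connected, simply connected, non-abelian nilpotent), with Lie algebra $\mathfrak h$ and one-dimensional center $\mathcal Z\subset\mathfrak h$. A Heisenberg four-manifold is a four-dimensional pseudo-Riemannian manifold $(M,g)$ foliated by the orbits of a principal isometric action of $\mathrm{H}$. Standing assumptions: the orbits are non-degenerate and (after passing to the universal covering and up to an overall sign of the metric) $M=\mathcal I\times \mathrm{H}$, $\mathcal I\subset\mathbb R$ an open interval, $g=\varepsilon\, dt^2+\chi_t$, with $\{\chi_t\}_{t\in\mathcal I}$ a smooth family of left-invariant metrics on $\mathrm{H}$; in neutral signature $\varepsilon=-1$ and $\chi_t$ is Lorentzian of signature $(-,+,+)$. $\mathcal Z_t\subset T_{(t,e)}(\{t\}\times \mathrm{H})\cong\mathfrak h$ is the line corresponding to $\mathcal Z$; its causal character is taken with respect to $\chi_t$. Einstein means $\mathrm{Ric}^g=\Lambda g$ with $\Lambda\in\mathbb R$ constant. *)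

theory Defs
  imports "HOL-Analysis.Analysis"
begin

section \<open>Pseudo-Riemannian geometry on an open subset of a Euclidean space\<close>

abbreviation dir_deriv ::
    "('a::euclidean_space \<Rightarrow> 'b::euclidean_space) \<Rightarrow> 'a \<Rightarrow> 'a \<Rightarrow> 'b" where
  "dir_deriv f x u \<equiv> frechet_derivative f (at x) u"

fun iter_dir_deriv ::
    "'a list \<Rightarrow> ('a::euclidean_space \<Rightarrow> 'b::euclidean_space) \<Rightarrow> 'a \<Rightarrow> 'b" where
  "iter_dir_deriv [] f = f"
| "iter_dir_deriv (u # us) f = (\<lambda>x. dir_deriv (iter_dir_deriv us f) x u)"

text \<open>For open \<open>S\<close> this is \<open>C\<^sup>\<infinity>\<close>: if all iterated directional derivatives are differentiable,
  then they are all continuous.\<close>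

definition smooth_on ::
    "'a set \<Rightarrow> ('a::euclidean_space \<Rightarrow> 'b::euclidean_space) \<Rightarrow> bool" where
  "smooth_on S f \<longleftrightarrow> open S \<and> (\<forall>us. iter_dir_deriv us f differentiable_on S)"

definition symmetric_form :: "('a \<Rightarrow> 'a \<Rightarrow> real) \<Rightarrow> bool" where
  "symmetric_form b \<longleftrightarrow> (\<forall>u v. b u v = b v u)"

definition nondegenerate :: "('a::euclidean_space \<Rightarrow> 'a \<Rightarrow> real) \<Rightarrow> bool" where
  "nondegenerate b \<longleftrightarrow> (\<forall>u. (\<forall>v. b u v = 0) \<longrightarrow> u = 0)"

text \<open>Signature with \<open>p\<close> minus signs and \<open>q\<close> plus signs: there is a \<open>b\<close>-orthogonal basis
  \<open>N \<union> P\<close> with \<open>b\<close> negative on the \<open>p\<close> vectors of \<open>N\<close> and positive on the \<open>q\<close> vectors of \<open>P\<close>.\<close>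

definition has_signature ::
    "('a::euclidean_space \<Rightarrow> 'a \<Rightarrow> real) \<Rightarrow> nat \<Rightarrow> nat \<Rightarrow> bool" where
  "has_signature b p q \<longleftrightarrow>
     (\<exists>N P. finite N \<and> finite P \<and> card N = p \<and> card P = q \<and> N \<inter> P = {} \<and>
        independent (N \<union> P) \<and> span (N \<union> P) = UNIV \<and>
        (\<forall>u\<in>N \<union> P. \<forall>v\<in>N \<union> P. u \<noteq> v \<longrightarrow> b u v = 0) \<and>
        (\<forall>u\<in>N. b u u < 0) \<and> (\<forall>u\<in>P. b u u > 0))"

text \<open>Tangent spaces of an open \<open>S \<subseteq> 'a\<close> are identified with \<open>'a\<close>; \<open>g x u v\<close> is the value at \<open>x\<close>
  of the metric on the tangent vectors \<open>u\<close> and \<open>v\<close>.\<close>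

type_synonym 'a metric_tensor = "'a \<Rightarrow> 'a \<Rightarrow> 'a \<Rightarrow> real"

definition pseudo_riemannian_metric :: "'a set \<Rightarrow> 'a::euclidean_space metric_tensor \<Rightarrow> bool" where
  "pseudo_riemannian_metric S g \<longleftrightarrow>
     open S \<and>
     (\<forall>x\<in>S. bilinear (g x) \<and> symmetric_form (g x) \<and> nondegenerate (g x)) \<and>
     (\<forall>u v. smooth_on S (\<lambda>x. g x u v))"

text \<open>The Levi-Civita derivative at \<open>x\<close> of the constant field \<open>v\<close> in direction \<open>u\<close>, given by the
  Koszul formula for constant (hence commuting) vector fields; on pairs of basis vectors these
  are the Christoffel symbols.\<close>

definition christoffel :: "'a::euclidean_space metric_tensor \<Rightarrow> 'a \<Rightarrow> 'a \<Rightarrow> 'a \<Rightarrow> 'a" where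
  "christoffel g x u v = (THE w. \<forall>z. 2 * g x w z =
      dir_deriv (\<lambda>y. g y v z) x u + dir_deriv (\<lambda>y. g y u z) x v - dir_deriv (\<lambda>y. g y u v) x z)"

definition nabla ::
    "'a::euclidean_space metric_tensor \<Rightarrow> ('a \<Rightarrow> 'a) \<Rightarrow> ('a \<Rightarrow> 'a) \<Rightarrow> 'a \<Rightarrow> 'a" where
  "nabla g X Y x = dir_deriv Y x (X x) + christoffel g x (X x) (Y x)"

text \<open>\<open>R(u,v)w = \<nabla>\<^sub>u\<nabla>\<^sub>v w - \<nabla>\<^sub>v\<nabla>\<^sub>u w - \<nabla>\<^bsub>[u,v]\<^esub> w\<close>, evaluated on the extensions of the tangent
  vectors to constant fields, for which \<open>[u,v] = 0\<close>.\<close>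

definition riemann :: "'a::euclidean_space metric_tensor \<Rightarrow> 'a \<Rightarrow> 'a \<Rightarrow> 'a \<Rightarrow> 'a \<Rightarrow> 'a" where
  "riemann g x u v w =
     nabla g (\<lambda>_. u) (nabla g (\<lambda>_. v) (\<lambda>_. w)) x - nabla g (\<lambda>_. v) (nabla g (\<lambda>_. u) (\<lambda>_. w)) x"

text \<open>\<open>Ric(v,w)\<close> is the trace of \<open>u \<mapsto> R(u,v)w\<close>.\<close>

definition ricci :: "'a::euclidean_space metric_tensor \<Rightarrow> 'a metric_tensor" where
  "ricci g x v w = (\<Sum>b\<in>Basis. riemann g x b v w \<bullet> b)"

definition einstein_metric :: "'a set \<Rightarrow> 'a::euclidean_space metric_tensor \<Rightarrow> bool" where
  "einstein_metric S g \<longleftrightarrow>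
     pseudo_riemannian_metric S g \<and>
     (\<exists>\<Lambda>. \<forall>x\<in>S. \<forall>u v. ricci g x u v = \<Lambda> * g x u v)"

definition lie_bracket ::
    "('a::euclidean_space \<Rightarrow> 'a) \<Rightarrow> ('a \<Rightarrow> 'a) \<Rightarrow> 'a \<Rightarrow> 'a" where
  "lie_bracket X Y x = dir_deriv Y x (X x) - dir_deriv X x (Y x)"

text \<open>Causal character of a subspace \<open>L\<close>; it is used for lines only, where it is the causal
  character of any generator.\<close>

definition timelike :: "('a::zero \<Rightarrow> 'a \<Rightarrow> real) \<Rightarrow> 'a set \<Rightarrow> bool" where
  "timelike b L \<longleftrightarrow> (\<forall>z\<in>L - {0}. b z z < 0)"

definition spacelike :: "('a::zero \<Rightarrow> 'a \<Rightarrow> real) \<Rightarrow> 'a set \<Rightarrow> bool" where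
  "spacelike b L \<longleftrightarrow> (\<forall>z\<in>L - {0}. b z z > 0)"

definition lightlike :: "('a::zero \<Rightarrow> 'a \<Rightarrow> real) \<Rightarrow> 'a set \<Rightarrow> bool" where
  "lightlike b L \<longleftrightarrow> (\<forall>z\<in>L - {0}. b z z = 0)"


section \<open>The Heisenberg group\<close>

text \<open>\<open>(a, b, c)\<close> stands for the unipotent upper triangular matrix with rows \<open>1 a c\<close>, \<open>0 1 b\<close>,
  \<open>0 0 1\<close>; the neutral element is \<open>0\<close>.\<close>

type_synonym heis = "real \<times> real \<times> real"

fun heis_mult :: "heis \<Rightarrow> heis \<Rightarrow> heis" where
  "heis_mult (a, b, c) (a', b', c') = (a + a', b + b', c + c' + a * b')"

text \<open>The Lie algebra is the tangent space \<open>heis\<close> at \<open>0\<close>, with the bracket of left-invariant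
  vector fields.\<close>

definition left_field :: "heis \<Rightarrow> heis \<Rightarrow> heis" where
  "left_field u p = dir_deriv (heis_mult p) 0 u"

definition heis_bracket :: "heis \<Rightarrow> heis \<Rightarrow> heis" where
  "heis_bracket u v = lie_bracket (left_field u) (left_field v) 0"

definition heis_center :: "heis set" where
  "heis_center = {z. \<forall>v. heis_bracket z v = 0}"

definition left_invariant :: "heis metric_tensor \<Rightarrow> bool" where
  "left_invariant h \<longleftrightarrow>
     (\<forall>p x u v. h (heis_mult p x) (dir_deriv (heis_mult p) x u) (dir_deriv (heis_mult p) x v)
        = h x u v)"

lemma heis_mult_assoc: "heis_mult (heis_mult p q) r = heis_mult p (heis_mult q r)"
  by (cases p; cases q; cases r) (simp add: algebra_simps)

lemma heis_mult_0 [simp]: "heis_mult 0 p = p" "heis_mult p 0 = p"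
  by (cases p; simp add: zero_prod_def)+

lemma heis_mult_inverse: "\<exists>q. heis_mult p q = 0 \<and> heis_mult q p = 0"
proof (cases p)
  case (fields a b c)
  then show ?thesis
    by (intro exI[of _ "(- a, - b, a * b - c)"]) (simp add: zero_prod_def algebra_simps)
qed

lemma dir_deriv_heis_mult:
  "dir_deriv (heis_mult p) x u = (fst u, fst (snd u), snd (snd u) + fst p * fst (snd u))"
proof -
  have eq: "heis_mult p = (\<lambda>y. (fst p + fst y, fst (snd p) + fst (snd y),
      snd (snd p) + snd (snd y) + fst p * fst (snd y)))"
    by (rule ext) (metis heis_mult.simps prod.collapse)
  have "(heis_mult p has_derivative
      (\<lambda>u. (fst u, fst (snd u), snd (snd u) + fst p * fst (snd u)))) (at x)"
    unfolding eq by (auto intro!: derivative_eq_intros)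
  then show ?thesis
    by (simp add: frechet_derivative_at[symmetric])
qed

lemma left_field_eq:
  "left_field u p = (fst u, fst (snd u), snd (snd u) + fst p * fst (snd u))"
  by (simp add: left_field_def dir_deriv_heis_mult)

lemma heis_bracket_eq:
  "heis_bracket u v = (0, 0, fst u * fst (snd v) - fst v * fst (snd u))"
proof -
  have D: "dir_deriv (left_field w) x s = (0, 0, fst s * fst (snd w))" for w x s
  proof -
    have "left_field w = (\<lambda>p. (fst w, fst (snd w), snd (snd w) + fst p * fst (snd w)))"
      by (rule ext) (rule left_field_eq)
    moreover have "((\<lambda>p. (fst w, fst (snd w), snd (snd w) + fst p * fst (snd w)))
        has_derivative (\<lambda>s. (0, 0, fst s * fst (snd w)))) (at x)"
      by (auto intro!: derivative_eq_intros)
    ultimately show ?thesis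
      by (simp add: frechet_derivative_at[symmetric])
  qed
  show ?thesis
    by (simp add: heis_bracket_def lie_bracket_def D left_field_eq)
qed

lemma heis_center_eq: "heis_center = span {(0, 0, 1)}"
proof -
  have "heis_center = {(0, 0, c) | c. True}"
  proof (intro set_eqI iffI)
    fix z assume z: "z \<in> heis_center"
    have "heis_bracket z (1, 0, 0) = 0" "heis_bracket z (0, 1, 0) = 0"
      using z by (auto simp: heis_center_def)
    then show "z \<in> {(0, 0, c) | c. True}"
      by (cases z) (auto simp: heis_bracket_eq zero_prod_def)
  qed (auto simp: heis_center_def heis_bracket_eq zero_prod_def)
  also have "\<dots> = span {(0, 0, 1)}"
    by (auto simp: span_singleton image_def)
  finally show ?thesis .
qed


section \<open>Heisenberg four-manifolds\<close>

text \<open>The metric \<open>\<epsilon> dt\<^sup>2 + h\<^sub>t\<close> on \<open>I \<times> H\<close>.\<close>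

definition heisenberg_metric ::
    "real \<Rightarrow> (real \<Rightarrow> heis metric_tensor) \<Rightarrow> (real \<times> heis) metric_tensor" where
  "heisenberg_metric \<epsilon> h = (\<lambda>(t, x) (a, u) (b, v). \<epsilon> * (a * b) + h t x u v)"

definition left_invariant_metric_family :: "real set \<Rightarrow> (real \<Rightarrow> heis metric_tensor) \<Rightarrow> bool" where
  "left_invariant_metric_family I h \<longleftrightarrow>
     (\<forall>t\<in>I. pseudo_riemannian_metric UNIV (h t) \<and> left_invariant (h t)) \<and>
     (\<forall>u v. smooth_on (I \<times> UNIV) (\<lambda>(t, x). h t x u v))"

text \<open>Neutral signature, normalised by the overall sign of the metric: \<open>\<epsilon> = -1\<close> and every \<open>h\<^sub>t\<close>
  is Lorentzian of signature \<open>(-,+,+)\<close>.\<close>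

definition neutral_heisenberg_manifold ::
    "real set \<Rightarrow> real \<Rightarrow> (real \<Rightarrow> heis metric_tensor) \<Rightarrow> bool" where
  "neutral_heisenberg_manifold I \<epsilon> h \<longleftrightarrow>
     open I \<and> is_interval I \<and> I \<noteq> {} \<and>
     left_invariant_metric_family I h \<and>
     \<epsilon> = -1 \<and> (\<forall>t\<in>I. \<forall>x. has_signature (h t x) 1 2)"

end

theory Submission
  imports Defs
begin

text \<open>Only the mixed Ricci components are needed. With \<open>A = \<chi>\<^sup>-\<^sup>1 \<chi>' / 2\<close> the shape operator of the orbits,
  unimodularity of the Heisenberg algebra turns \<open>Ric(\<partial>\<^sub>t, v) = 0\<close> into \<open>tr (A \<circ> ad\<^sub>v) = 0\<close>. Since brackets
  take values in the centre, this says that \<open>A\<close> maps the central vector \<open>Z\<close> to a multiple of itself, i.e.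
  \<open>\<chi>'(Z, \<cdot>) = c \<chi>(Z, \<cdot>)\<close> for a function \<open>c\<close> of \<open>t\<close>. The nowhere vanishing covector \<open>\<chi>\<^sub>t(Z, \<cdot>)\<close> therefore
  has constant direction: normalised to length one it has derivative zero. Hence \<open>\<chi>\<^sub>t(Z, Z)\<close> is a positive
  multiple of \<open>\<chi>\<^sub>s(Z, Z)\<close> for all \<open>s\<close> and \<open>t\<close>.\<close>

section \<open>Linear equations depending on a parameter, and curves parallel to their
  derivative\<close>

lemma nondegenerate_represents:
  fixes b :: "'a::euclidean_space \<Rightarrow> 'a \<Rightarrow> real"
  assumes b: "bilinear b" "nondegenerate b" and f: "linear f"
  shows "\<exists>w. \<forall>z. b w z = f z"
proof -
  have lin: "linear (\<lambda>w. b w z)" "linear (b w)" for w z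
    using b(1) by (auto simp: bilinear_def)
  \<comment> \<open>\<open>T w\<close> lists the values of \<open>b w\<close> on the standard basis.
    Nondegeneracy makes \<open>T\<close> injective, hence surjective by dimension, so any values on
    the basis are attained.\<close>
  define T where "T w = (\<Sum>i\<in>Basis. b w i *\<^sub>R i)" for w
  have T: "linear T"
    unfolding T_def using lin(1)
    by (intro linear_compose_sum ballI) (simp add: linear_iff algebra_simps)
  have ext: "b w = k" if "linear k" "\<And>i. i \<in> Basis \<Longrightarrow> T w \<bullet> i = k i" for w k
    using lin(2) that by (intro linear_eq_stdbasis) (auto simp: T_def)
  have "inj T"
    unfolding linear_injective_0[OF T]
  proof (intro allI impI)
    fix w assume "T w = 0"
    then have "b w = (\<lambda>_. 0)"
      by (intro ext) (auto simp: linear_iff)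
    then show "w = 0"
      using b(2) by (auto simp: nondegenerate_def)
  qed
  then obtain w where "T w = (\<Sum>i\<in>Basis. f i *\<^sub>R i)"
    using surjD[OF linear_injective_imp_surjective[OF T]] by metis
  then have "b w = f"
    using f by (intro ext) auto
  then show ?thesis
    by auto
qed

lemma nondegenerate_cancel:
  assumes "bilinear b" "nondegenerate b" "\<And>z. b v z = b w z"
  shows "v = w"
proof -
  have "b (v - w) z = 0" for z
    using assms(1,3) by (simp add: bilinear_lsub)
  then show ?thesis
    using assms(2) by (force simp: nondegenerate_def)
qed

text \<open>An injective \<open>L0\<close> is bounded below by some \<open>c > 0\<close>.
  Convergence on a basis is convergence in operator norm, so the error of replacing
  \<open>L s\<close> by \<open>L0\<close> is eventually absorbed by half of this bound, and the
  residual \<open>L s (q s) - L s r\<close> tends to zero.\<close>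

lemma tendsto_linear_solution:
  fixes L :: "'c \<Rightarrow> 'a::euclidean_space \<Rightarrow> 'b::euclidean_space"
  assumes lin: "\<forall>\<^sub>F s in F. linear (L s)" and L0: "linear L0" "inj L0"
    and L: "\<And>i. i \<in> Basis \<Longrightarrow> ((\<lambda>s. L s i) \<longlongrightarrow> L0 i) F"
    and q: "((\<lambda>s. L s (q s)) \<longlongrightarrow> L0 r) F"
  shows "(q \<longlongrightarrow> r) F"
proof -
  obtain c where c: "c > 0" "\<And>x. norm (L0 x) \<ge> c * norm x"
    using linear_inj_bounded_below_pos[OF L0] by metis
  \<comment> \<open>\<open>e s\<close> bounds the operator norm of \<open>L s - L0\<close>.\<close>
  define e where "e s = (\<Sum>i\<in>Basis. norm (L s i - L0 i))" for s
  have e0: "(e \<longlongrightarrow> 0) F"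
    unfolding e_def using L by (intro tendsto_null_sum tendsto_norm_zero) (simp add: LIM_zero)
  have err: "norm (L s x - L0 x) \<le> e s * norm x" if "linear (L s)" for s x
  proof -
    have D: "linear (\<lambda>x. L s x - L0 x)"
      using that L0(1) by (rule linear_compose_sub)
    have "L s x - L0 x = (\<Sum>i\<in>Basis. (x \<bullet> i) *\<^sub>R (L s i - L0 i))"
      using linear_sum[OF D, of "\<lambda>i. (x \<bullet> i) *\<^sub>R i" Basis] linear_scale[OF D]
      by (simp add: euclidean_representation)
    also have "norm \<dots> \<le> (\<Sum>i\<in>Basis. norm (L s i - L0 i) * norm x)"
      by (intro sum_norm_le) (simp add: Basis_le_norm mult.commute[of "norm (L s _ - L0 _)"] mult_right_mono)
    finally show ?thesis
      by (simp add: e_def sum_distrib_right)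
  qed
  have "\<forall>\<^sub>F s in F. e s < c / 2"
    using e0 c(1) by (intro order_tendstoD(2)) auto
  with lin have "\<forall>\<^sub>F s in F. norm (q s - r) \<le> (norm (L s (q s) - L0 r) + e s * norm r) * (2 / c)"
  proof eventually_elim
    case (elim s)
    let ?x = "q s - r"
    have "c * norm ?x \<le> norm (L0 ?x)"
      by (rule c(2))
    also have "\<dots> \<le> norm (L s ?x) + norm (L s ?x - L0 ?x)"
      using norm_triangle_ineq4[of "L s ?x" "L s ?x - L0 ?x"] by simp
    also have "norm (L s ?x - L0 ?x) \<le> c / 2 * norm ?x"
      using err[OF elim(1), of ?x] elim(2) mult_right_mono[of "e s" "c / 2" "norm ?x"] by simp
    also have "L s ?x = (L s (q s) - L0 r) - (L s r - L0 r)"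
      using elim(1) by (simp add: linear_diff)
    also have "norm \<dots> \<le> norm (L s (q s) - L0 r) + e s * norm r"
      using err[OF elim(1), of r] norm_triangle_ineq4[of "L s (q s) - L0 r" "L s r - L0 r"] by linarith
    finally show ?case
      using c(1) by (simp add: field_simps)
  qed
  moreover have "((\<lambda>s. (norm (L s (q s) - L0 r) + e s * norm r) * (2 / c)) \<longlongrightarrow> 0) F"
    using q by (intro tendsto_mult_left_zero tendsto_add_zero tendsto_norm_zero e0) (simp add: LIM_zero)
  ultimately have "((\<lambda>s. q s - r) \<longlongrightarrow> 0) F"
    by (rule Lim_null_comparison)
  then show ?thesis
    by (simp add: LIM_zero_iff)
qed

lemma has_vector_derivativeI_quotient:
  fixes a :: "real \<Rightarrow> 'a::real_normed_vector"
  assumes "((\<lambda>s. (a s - a t) /\<^sub>R (s - t)) \<longlongrightarrow> r) (at t)"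
  shows "(a has_vector_derivative r) (at t)"
proof -
  have "((\<lambda>s. norm ((a s - a t) /\<^sub>R (s - t) - r)) \<longlongrightarrow> 0) (at t)"
    using assms by (intro tendsto_norm_zero) (simp add: LIM_zero)
  then have "((\<lambda>s. norm ((1 / norm (s - t)) *\<^sub>R (a s - (a t + (s - t) *\<^sub>R r)))) \<longlongrightarrow> 0) (at t)"
  proof (rule Lim_transform_eventually)
    show "\<forall>\<^sub>F s in at t. norm ((a s - a t) /\<^sub>R (s - t) - r) =
        norm ((1 / norm (s - t)) *\<^sub>R (a s - (a t + (s - t) *\<^sub>R r)))"
      unfolding eventually_at_filter
    proof (intro always_eventually allI impI)
      fix s assume "s \<noteq> t"
      then have "a s - (a t + (s - t) *\<^sub>R r) = (s - t) *\<^sub>R ((a s - a t) /\<^sub>R (s - t) - r)"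
        by (simp add: scaleR_diff_right)
      then show "norm ((a s - a t) /\<^sub>R (s - t) - r) =
          norm ((1 / norm (s - t)) *\<^sub>R (a s - (a t + (s - t) *\<^sub>R r)))"
        using \<open>s \<noteq> t\<close> by simp
    qed
  qed
  then show ?thesis
    unfolding has_vector_derivative_def has_derivative_within
    by (intro conjI bounded_linear_scaleR_left) (rule tendsto_norm_zero_cancel)
qed

text \<open>The difference quotient \<open>q\<close> of \<open>a\<close> solves a linear system with converging matrix and right-hand
  side, so no formula for the inverse matrix is needed.\<close>

lemma differentiable_representative:
  fixes b :: "real \<Rightarrow> 'a::euclidean_space \<Rightarrow> 'a \<Rightarrow> real"
  assumes I: "open I" "t \<in> I"
    and b: "\<And>s. s \<in> I \<Longrightarrow> bilinear (b s)" "nondegenerate (b t)"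
    and db: "\<And>u v. ((\<lambda>s. b s u v) has_real_derivative b' u v) (at t)"
    and dk: "\<And>z. ((\<lambda>s. k s z) has_real_derivative k' z) (at t)"
    and a: "\<And>s z. s \<in> I \<Longrightarrow> b s (a s) z = k s z"
  shows "a differentiable (at t)"
proof -
  define L where "L s w = (\<Sum>i\<in>Basis. b s w i *\<^sub>R i)" for s w
  define q where "q s = (a s - a t) /\<^sub>R (s - t)" for s
  have lin: "linear (\<lambda>w. b s w z)" "linear (b s w)" if "s \<in> I" for s w z
    using b(1)[OF that] by (auto simp: bilinear_def)
  have L: "linear (L s)" if "s \<in> I" for s
    unfolding L_def using lin(1)[OF that]
    by (intro linear_compose_sum ballI) (simp add: linear_iff algebra_simps)
  have inj: "inj (L t)"
    unfolding linear_injective_0[OF L[OF I(2)]]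
  proof (intro allI impI)
    fix w assume w: "L t w = 0"
    have "b t w i = 0" if "i \<in> Basis" for i
      using arg_cong[OF w, of "\<lambda>x. x \<bullet> i"] that by (simp add: L_def)
    then have "b t w = (\<lambda>_. 0)"
      using lin(2)[OF I(2)] by (intro linear_eq_stdbasis) (auto simp: linear_iff)
    then show "w = 0"
      using b(2) by (auto simp: nondegenerate_def)
  qed
  \<comment> \<open>Differentiating \<open>b s (a s) z = k s z\<close> formally gives
    \<open>b t r z = k' z - b' (a t) z\<close> for the derivative \<open>r\<close> of
    \<open>a\<close>; here \<open>r\<close> is obtained by solving this equation.\<close>
  obtain r where r: "L t r = (\<Sum>i\<in>Basis. (k' i - b' (a t) i) *\<^sub>R i)"
    using surjD[OF linear_injective_imp_surjective[OF L[OF I(2)] inj]] by metis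
  have ev: "\<forall>\<^sub>F s in at t. s \<in> I"
    using I by (rule eventually_at_in_open')
  have "(q \<longlongrightarrow> r) (at t)"
  proof (rule tendsto_linear_solution[where L = L and ?L0.0 = "L t"])
    show "\<forall>\<^sub>F s in at t. linear (L s)"
      using ev by eventually_elim (rule L)
    show "((\<lambda>s. L s i) \<longlongrightarrow> L t i) (at t)" for i
      unfolding L_def
      using db by (intro tendsto_sum tendsto_scaleR tendsto_const) (meson DERIV_isCont isContD)
    have "((\<lambda>s. \<Sum>i\<in>Basis. ((k s i - k t i) / (s - t) - (b s (a t) i - b t (a t) i) / (s - t)) *\<^sub>R i)
        \<longlongrightarrow> L t r) (at t)"
      unfolding r using db dk
      by (intro tendsto_sum tendsto_scaleR tendsto_const tendsto_diff)
        (auto simp: has_field_derivative_iff)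
    then show "((\<lambda>s. L s (q s)) \<longlongrightarrow> L t r) (at t)"
    proof (rule Lim_transform_eventually)
      show "\<forall>\<^sub>F s in at t. (\<Sum>i\<in>Basis. ((k s i - k t i) / (s - t) -
          (b s (a t) i - b t (a t) i) / (s - t)) *\<^sub>R i) = L s (q s)"
        using ev
      proof eventually_elim
        case (elim s)
        then have "b s (q s) i = (k s i - k t i) / (s - t) - (b s (a t) i - b t (a t) i) / (s - t)" for i
          using b(1) I(2) a
          by (simp add: q_def bilinear_lmul bilinear_lsub divide_inverse algebra_simps)
        then show ?case
          by (simp add: L_def)
      qed
    qed
  qed (use L I inj in auto)
  then have "(a has_vector_derivative r) (at t)"
    unfolding q_def by (rule has_vector_derivativeI_quotient)
  then show ?thesis
    by (rule differentiableI_vector)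
qed

text \<open>The norm of \<open>X\<close> satisfies the same scalar equation as \<open>X\<close>,
  with the same \<open>c\<close>, so the two contributions cancel in the derivative of the unit
  vector. In this way \<open>c\<close>, whose regularity is not assumed, never has to be
  integrated.\<close>

lemma interval_parallel_derivative:
  fixes X :: "real \<Rightarrow> 'a::euclidean_space"
  assumes I: "is_interval I" "s \<in> I" "t \<in> I"
    and X: "\<And>\<tau>. \<tau> \<in> I \<Longrightarrow> (X has_vector_derivative c \<tau> *\<^sub>R X \<tau>) (at \<tau>)"
    and nz: "\<And>\<tau>. \<tau> \<in> I \<Longrightarrow> X \<tau> \<noteq> 0"
  shows "\<exists>k>0. X t = k *\<^sub>R X s"
proof -
  have "((\<lambda>\<tau>. X \<tau> /\<^sub>R norm (X \<tau>)) has_derivative (\<lambda>_. 0)) (at \<tau> within I)" if "\<tau> \<in> I" for \<tau>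
  proof -
    have X': "(X has_derivative (\<lambda>d. (d * c \<tau>) *\<^sub>R X \<tau>)) (at \<tau>)"
      using X[OF that] by (simp add: has_vector_derivative_def)
    have n: "norm (X \<tau>) > 0"
      using nz[OF that] by simp
    have "X \<tau> \<bullet> sgn (X \<tau>) = norm (X \<tau>)"
      using n by (simp add: sgn_div_norm dot_square_norm power2_eq_square)
    then have "((\<lambda>\<tau>. norm (X \<tau>)) has_real_derivative (c \<tau> * norm (X \<tau>))) (at \<tau>)"
      using has_derivative_compose[OF X' has_derivative_norm[OF nz[OF that]]]
      by (simp add: has_field_derivative_def mult_commute_abs ac_simps)
    from DERIV_inverse_fun[OF this] have "((\<lambda>\<tau>. inverse (norm (X \<tau>))) has_real_derivative (- c \<tau> / norm (X \<tau>))) (at \<tau>)"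
      using n by (simp add: field_simps)
    then have "((\<lambda>\<tau>. X \<tau> /\<^sub>R norm (X \<tau>)) has_vector_derivative 0) (at \<tau>)"
      using has_vector_derivative_scaleR[OF _ X[OF that], of "\<lambda>\<tau>. inverse (norm (X \<tau>))" "- c \<tau> / norm (X \<tau>)"]
      by (simp add: divide_inverse mult.commute)
    then have "((\<lambda>\<tau>. X \<tau> /\<^sub>R norm (X \<tau>)) has_derivative (\<lambda>_. 0)) (at \<tau>)"
      by (simp add: has_vector_derivative_def)
    then show ?thesis
      by (rule has_derivative_at_withinI)
  qed
  then have "X t /\<^sub>R norm (X t) = X s /\<^sub>R norm (X s)"
    by (rule has_derivative_zero_unique[OF is_interval_convex[OF I(1)] _ I(2,3), symmetric])
  then have "norm (X t) *\<^sub>R (X t /\<^sub>R norm (X t)) = norm (X t) *\<^sub>R (X s /\<^sub>R norm (X s))"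
    by simp
  then have "X t = (norm (X t) / norm (X s)) *\<^sub>R X s"
    using nz[OF I(3)] by (simp add: divide_inverse)
  then show ?thesis
    using nz I by (intro exI[of _ "norm (X t) / norm (X s)"]) simp
qed

section \<open>Christoffel symbols and Ricci tensor in coordinates\<close>

text \<open>Nondegeneracy makes the solution of the Koszul formula unique, so a Christoffel symbol
  is found by guessing it and testing against all \<open>z\<close>.\<close>

lemma christoffel_eqI:
  assumes "bilinear (g x)" "nondegenerate (g x)"
    and "\<And>z. 2 * g x w z = dir_deriv (\<lambda>y. g y v z) x u + dir_deriv (\<lambda>y. g y u z) x v
      - dir_deriv (\<lambda>y. g y u v) x z"
  shows "christoffel g x u v = w"
  unfolding christoffel_def
proof (rule the_equality)
  fix w'
  assume "\<forall>z. 2 * g x w' z = dir_deriv (\<lambda>y. g y v z) x u + dir_deriv (\<lambda>y. g y u z) x v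
      - dir_deriv (\<lambda>y. g y u v) x z"
  then have "g x w' z = g x w z" for z
    using assms(3)[of z] by (metis mult_cancel_left zero_neq_numeral)
  then show "w' = w"
    by (rule nondegenerate_cancel[OF assms(1,2)])
qed (use assms(3) in auto)

text \<open>A constant field has zero derivative, so its covariant derivative is a Christoffel
  symbol alone; only the outer covariant derivatives contribute derivative terms.\<close>

lemma ricci_eq_sum_christoffel:
  "ricci g x v w = (\<Sum>b\<in>Basis.
      (dir_deriv (\<lambda>y. christoffel g y v w) x b + christoffel g x b (christoffel g x v w)
       - dir_deriv (\<lambda>y. christoffel g y b w) x v - christoffel g x v (christoffel g x b w)) \<bullet> b)"
proof -
  have "nabla g (\<lambda>_. v) (\<lambda>_. w) = (\<lambda>y. christoffel g y v w)" for v
    by (simp add: nabla_def fun_eq_iff)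
  then show ?thesis
    by (simp add: ricci_def riemann_def nabla_def algebra_simps)
qed

lemma sum_Basis_real4:
  "(\<Sum>b\<in>Basis. f b) =
    f (1, 0) + f (0, 1, 0, 0) + f (0, 0, 1, 0) + f (0, 0, 0, 1 :: real)"
  for f :: "real \<times> heis \<Rightarrow> real"
proof -
  have sum_prod: "sum f (Basis :: ('a::euclidean_space \<times> 'b::euclidean_space) set) =
      (\<Sum>i\<in>Basis. f (i, 0)) + (\<Sum>i\<in>Basis. f (0, i))" for f :: "_ \<Rightarrow> real"
    unfolding Basis_prod_def
    by (subst sum.union_disjoint) (auto simp: sum.reindex inj_on_def)
  show ?thesis
    by (simp add: sum_prod zero_prod_def)
qed

section \<open>Left translations of the Heisenberg group\<close>

abbreviation Z :: heis where "Z \<equiv> (0, 0, 1)"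

text \<open>The differential of left translation by \<open>p\<^sup>-\<^sup>1\<close>.\<close>

definition pull :: "heis \<Rightarrow> heis \<Rightarrow> heis" where
  "pull p u = u - (fst p * fst (snd u)) *\<^sub>R Z"

lemma pull_0 [simp]: "pull 0 u = u" "pull p 0 = 0"
  by (simp_all add: pull_def zero_prod_def)

text \<open>The differential of left translation by \<open>p\<close>.\<close>

definition push :: "heis \<Rightarrow> heis \<Rightarrow> heis" where
  "push p u = u + (fst p * fst (snd u)) *\<^sub>R Z"

lemma push_0 [simp]: "push 0 u = u"
  by (simp add: push_def zero_prod_def)

lemma pull_push [simp]: "pull p (push p u) = u"
  by (cases u) (simp add: pull_def push_def)

lemma left_invariantD:
  assumes "left_invariant h"
  shows "h p u v = h 0 (pull p u) (pull p v)"
proof -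
  have "dir_deriv (heis_mult p) 0 (pull p u) = u" for u
    by (cases u) (simp add: dir_deriv_heis_mult pull_def)
  with assms show ?thesis
    unfolding left_invariant_def by (metis heis_mult_0(2))
qed

section \<open>A left-invariant family and its time derivative\<close>

locale left_invariant_family =
  fixes I :: "real set" and h :: "real \<Rightarrow> heis metric_tensor"
  assumes open_I: "open I" and family: "left_invariant_metric_family I h"
begin

abbreviation "g \<equiv> heisenberg_metric (-1) h"

abbreviation "B s \<equiv> h s 0"

text \<open>This is \<chi>' at the neutral element; up to a constant factor, it is the second
  fundamental form of the orbit.\<close>

definition "K s u v = deriv (\<lambda>s. B s u v) s"

lemma bilinear_h: "s \<in> I \<Longrightarrow> bilinear (h s p)"
  and sym_h: "s \<in> I \<Longrightarrow> h s p u v = h s p v u"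
  and nondegenerate_h: "s \<in> I \<Longrightarrow> nondegenerate (h s p)"
  and h_eq: "s \<in> I \<Longrightarrow> h s p u v = B s (pull p u) (pull p v)"
  using family left_invariantD[of "h s"]
  unfolding left_invariant_metric_family_def pseudo_riemannian_metric_def symmetric_form_def
  by (blast+)

lemma linear_B:
  assumes "s \<in> I"
  shows "B s (u + u') v = B s u v + B s u' v" "B s (c *\<^sub>R u) v = c * B s u v"
    "B s u (v + v') = B s u v + B s u v'" "B s u (c *\<^sub>R v) = c * B s u v"
    "B s (u - u') v = B s u v - B s u' v" "B s u (v - v') = B s u v - B s u v'"
    "B s 0 v = 0" "B s u 0 = 0"
  using bilinear_h[OF assms, of 0]
  by (simp_all add: bilinear_ladd bilinear_radd bilinear_lmul bilinear_rmul
      bilinear_lsub bilinear_rsub bilinear_lzero bilinear_rzero)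

text \<open>Joint smoothness is restricted to the curve \<open>s \<mapsto> (s, 0)\<close>. Two time
  derivatives are taken: the first produces \<open>K\<close>, the second makes the shape operator
  differentiable.\<close>

lemma h_smooth:
  assumes "s \<in> I"
  shows "((\<lambda>s. B s u v) has_real_derivative K s u v) (at s)"
    and "(\<lambda>s. K s u v) differentiable (at s)"
proof -
  let ?F = "\<lambda>(t, x). h t x u v"
  have I: "open (I \<times> (UNIV :: heis set))"
    using open_I by (simp add: open_Times)
  have F: "?F differentiable_on (I \<times> UNIV)"
    and F1: "(\<lambda>y. dir_deriv ?F y (1, 0)) differentiable_on (I \<times> UNIV)"
  proof -
    have *: "iter_dir_deriv us ?F differentiable_on (I \<times> UNIV)" for us
      using family unfolding left_invariant_metric_family_def smooth_on_def by blast
    show "?F differentiable_on (I \<times> UNIV)"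
      using *[of "[]"] by simp
    show "(\<lambda>y. dir_deriv ?F y (1, 0)) differentiable_on (I \<times> UNIV)"
      using *[of "[(1, 0)]"] by simp
  qed
  have emb: "((\<lambda>s. (s, 0 :: heis)) has_derivative (\<lambda>d. (d, 0))) (at s)" for s :: real
    by (auto intro!: derivative_eq_intros)
  have D: "((\<lambda>s. B s u v) has_real_derivative dir_deriv ?F (s, 0) (1, 0)) (at s)" if "s \<in> I" for s
  proof -
    have dF: "(?F has_derivative dir_deriv ?F (s, 0)) (at (s, 0))"
      using F I that
      by (simp add: differentiable_on_eq_differentiable_at frechet_derivative_works zero_prod_def)
    have "(\<lambda>d. dir_deriv ?F (s, 0) (d, 0)) = (*) (dir_deriv ?F (s, 0) (1, 0))"
    proof
      show "dir_deriv ?F (s, 0) (d, 0) = dir_deriv ?F (s, 0) (1, 0) * d" for d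
        using linear_scale[OF has_derivative_linear[OF dF], of d "(1, 0)"] by simp
    qed
    then show ?thesis
      using has_derivative_compose[OF emb dF] by (simp add: has_field_derivative_def)
  qed
  then have K: "K s u v = dir_deriv ?F (s, 0) (1, 0)" if "s \<in> I" for s
    unfolding K_def using that by (intro DERIV_imp_deriv)
  show "((\<lambda>s. B s u v) has_real_derivative K s u v) (at s)"
    using D K assms by simp
  obtain D where "((\<lambda>y. dir_deriv ?F y (1, 0)) has_derivative D) (at (s, 0))"
    using F1 assms unfolding differentiable_on_eq_differentiable_at[OF I] differentiable_def by blast
  from has_derivative_compose[OF emb this]
  have "(\<lambda>s. dir_deriv ?F (s, 0) (1, 0)) differentiable (at s)"
    by (rule differentiableI)
  then show "(\<lambda>s. K s u v) differentiable (at s)"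
    unfolding differentiable_def using open_I assms K
    by (metis (no_types, lifting) has_derivative_transform_within_open)
qed

text \<open>Identities for \<open>B\<close> on the open set \<open>I\<close> may be differentiated;
  symmetry and bilinearity of \<open>K\<close> are obtained this way.\<close>

lemma K_unique:
  assumes "s \<in> I" "\<And>s. s \<in> I \<Longrightarrow> f s = B s u v" "(f has_real_derivative D) (at s)"
  shows "K s u v = D"
proof -
  have "(f has_real_derivative K s u v) (at s)"
    using h_smooth(1)[OF assms(1)] open_I assms(1)
    by (rule has_field_derivative_transform_within_open) (simp add: assms(2))
  then show ?thesis
    using assms(3) by (rule DERIV_unique)
qed

lemma K_sym:
  assumes s: "s \<in> I"
  shows "K s u v = K s v u"
  by (rule K_unique[OF s sym_h h_smooth(1)[OF s]])

lemma bilinear_K: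
  assumes s: "s \<in> I"
  shows "bilinear (K s)"
proof -
  have lin: "linear (\<lambda>u. K s u v)" for v
  proof (rule linearI)
    show "K s (u + u') v = K s u v + K s u' v" for u u'
      by (rule K_unique[OF s linear_B(1)[symmetric] DERIV_add[OF h_smooth(1)[OF s] h_smooth(1)[OF s]]])
    show "K s (c *\<^sub>R u) v = c *\<^sub>R K s u v" for c u
      unfolding real_scaleR_def
      by (rule K_unique[OF s linear_B(2)[symmetric] DERIV_cmult[OF h_smooth(1)[OF s]]])
  qed
  moreover have "linear (K s u)" for u
  proof -
    have "K s u = (\<lambda>v. K s v u)"
      using K_sym[OF s] by (rule ext)
    then show ?thesis
      using lin[of u] by argo
  qed
  ultimately show ?thesis
    unfolding bilinear_def by blast
qed

lemma linear_K:
  assumes "s \<in> I"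
  shows "K s (u + u') v = K s u v + K s u' v" "K s (c *\<^sub>R u) v = c * K s u v"
    "K s u (v + v') = K s u v + K s u v'" "K s u (c *\<^sub>R v) = c * K s u v"
    "K s (u - u') v = K s u v - K s u' v" "K s u (v - v') = K s u v - K s u v'"
    "K s 0 v = 0" "K s u 0 = 0"
  using bilinear_K[OF assms]
  by (simp_all add: bilinear_ladd bilinear_radd bilinear_lmul bilinear_rmul
      bilinear_lsub bilinear_rsub bilinear_lzero bilinear_rzero)


text \<open>The shape operator \<open>\<chi>\<^sup>-\<^sup>1 \<chi>' / 2\<close> at the neutral element.\<close>

definition "A s u = (SOME w. \<forall>z. B s w z = K s u z / 2)"

lemma A:
  assumes "s \<in> I"
  shows "B s (A s u) z = K s u z / 2"
proof -
  have "linear (\<lambda>z. K s u z / 2)"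
    using assms by (intro linearI) (simp_all add: linear_K add_divide_distrib)
  from nondegenerate_represents[OF bilinear_h[of s 0] nondegenerate_h[of s 0] this] assms
  have "\<exists>w. \<forall>z. B s w z = K s u z / 2"
    by blast
  from someI_ex[OF this] show ?thesis
    by (simp add: A_def del: split_paired_All)
qed

lemma linear_A:
  assumes "s \<in> I"
  shows "linear (A s)"
proof (rule linearI)
  show "A s (u + v) = A s u + A s v" for u v
    using assms by (intro nondegenerate_cancel[OF bilinear_h[of s 0] nondegenerate_h[of s 0]])
      (auto simp: linear_B linear_K A add_divide_distrib)
  show "A s (c *\<^sub>R u) = c *\<^sub>R A s u" for c u
    using assms by (intro nondegenerate_cancel[OF bilinear_h[of s 0] nondegenerate_h[of s 0]])
      (auto simp: linear_B linear_K A)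
qed

lemma A_differentiable:
  assumes "s \<in> I"
  shows "(\<lambda>s. A s u) differentiable (at s)"
proof (rule differentiable_representative[where b = B, OF open_I assms bilinear_h nondegenerate_h[OF assms]])
  show "((\<lambda>s. B s u v) has_real_derivative K s u v) (at s)" for u v
    by (rule h_smooth(1)[OF assms])
  show "((\<lambda>s. K s u z / 2) has_real_derivative deriv (\<lambda>s. K s u z) s / 2) (at s)" for z
    using h_smooth(2)[OF assms] by (intro DERIV_cdivide) (simp add: DERIV_deriv_iff_real_differentiable)
qed (auto simp: A)

section \<open>Christoffel symbols of the four-dimensional metric\<close>

lemma g_apply: "g (s, p) (a, u) (b, v) = h s p u v - a * b"
  by (simp add: heisenberg_metric_def)

lemma bilinear_g:
  assumes "s \<in> I"
  shows "bilinear (g (s, p))"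
  using bilinear_h[OF assms, of p]
  by (simp add: bilinear_def linear_iff heisenberg_metric_def split_beta algebra_simps)

lemma nondegenerate_g:
  assumes "s \<in> I"
  shows "nondegenerate (g (s, p))"
  unfolding nondegenerate_def
proof (intro allI impI)
  fix z assume z: "\<forall>w. g (s, p) z w = 0"
  obtain a u where au: "z = (a, u)"
    by (cases z)
  have "h s p u v = 0" for v
    using z[rule_format, of "(0, v)"] by (simp add: au g_apply)
  then have "u = 0"
    using nondegenerate_h[OF assms, of p] by (simp only: nondegenerate_def) blast
  moreover have "a = 0"
    using z[rule_format, of "(1, 0)"] bilinear_rzero[OF bilinear_h[OF assms]]
    by (simp add: au g_apply)
  ultimately show "z = 0"
    by (simp add: au zero_prod_def)
qed

text \<open>By left invariance, the metric coefficients at a group point depend on that point only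
  through its first coordinate, and are quadratic polynomials in it with coefficients taken from
  \<open>B\<close>.\<close>

lemma has_derivative_g:
  assumes s: "s \<in> I"
  shows "((\<lambda>y. g y z w) has_derivative (\<lambda>d. fst d * K s (pull p (snd z)) (pull p (snd w)) -
      fst (snd d) * (fst (snd (snd z)) * B s Z (pull p (snd w)) +
        fst (snd (snd w)) * B s Z (pull p (snd z))))) (at (s, p))"
proof -
  obtain a u b v where zw: "z = (a, u)" "w = (b, v)"
    by (metis surj_pair)
  let ?u = "fst (snd u)" and ?v = "fst (snd v)"
  \<comment> \<open>This is the expansion of \<open>B (pull q u) (pull q v) - a * b\<close> in
    powers of the first coordinate of \<open>q\<close>.\<close>
  define f where "f y = B (fst y) u v - a * b
      - fst (snd y) * (?u * B (fst y) Z v + ?v * B (fst y) Z u)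
      + (fst (snd y))\<^sup>2 * (?u * ?v * B (fst y) Z Z)" for y :: "real \<times> heis"
  have f: "g y z w = f y" if y_in: "y \<in> I \<times> UNIV" for y
  proof -
    obtain t q where y: "y = (t, q)" "t \<in> I"
      using y_in by (metis mem_Times_iff prod.collapse)
    then show ?thesis
      using h_eq[OF y(2), of q u v] sym_h[OF y(2), of 0 u Z] sym_h[OF y(2), of 0 v Z]
      by (simp add: zw g_apply f_def pull_def linear_B power2_eq_square algebra_simps del: scaleR_Pair)
  qed
  have dB: "((\<lambda>y. B (fst y) u v) has_derivative (\<lambda>d. fst d * K s u v)) (at (s, p))" for u v
  proof -
    have "((\<lambda>s. B s u v) has_derivative (*) (K s u v)) (at (fst (s, p)))"
      using h_smooth(1)[OF s] by (simp add: has_field_derivative_def)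
    from has_derivative_compose[OF has_derivative_fst[OF has_derivative_ident] this]
    show ?thesis
      by (simp add: mult.commute)
  qed
  have "(f has_derivative (\<lambda>d. fst d * K s (pull p u) (pull p v) -
      fst (snd d) * (?u * B s Z (pull p v) + ?v * B s Z (pull p u)))) (at (s, p))"
    unfolding f_def
    by (rule derivative_eq_intros dB refl)+
      (simp add: fun_eq_iff pull_def linear_B[OF s] linear_K[OF s] K_sym[OF s, of u Z] K_sym[OF s, of v Z]
        sym_h[OF s, of 0 u Z] sym_h[OF s, of 0 v Z] power2_eq_square algebra_simps
        del: scaleR_Pair)
  then show ?thesis
    unfolding zw snd_conv
    by (rule has_derivative_transform_within_open[where s = "I \<times> UNIV"])
      (use s open_I f in \<open>auto simp: open_Times zw\<close>)
qed

lemma dir_deriv_g: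
  assumes "s \<in> I"
  shows "dir_deriv (\<lambda>y. g y z w) (s, p) d = fst d * K s (pull p (snd z)) (pull p (snd w)) -
      fst (snd d) * (fst (snd (snd z)) * B s Z (pull p (snd w)) +
        fst (snd (snd w)) * B s Z (pull p (snd z)))"
  by (simp add: frechet_derivative_at[OF has_derivative_g[OF assms], symmetric])

text \<open>Pairings with the time field are constant, so only the time derivative of
  \<open>g z w\<close> survives in the Koszul formula. The symbol is given at every \<open>p\<close>
  because it will be differentiated in space.\<close>

lemma christoffel_time:
  assumes s: "s \<in> I"
  shows "christoffel g (s, p) z (1, 0) = (0, push p (A s (pull p (snd z))))"
proof (rule christoffel_eqI[where g = g and x = "(s, p)", OF bilinear_g[OF s] nondegenerate_g[OF s]])
  fix w :: "real \<times> heis"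
  have "g (s, p) (0, push p (A s (pull p (snd z)))) w = K s (pull p (snd z)) (pull p (snd w)) / 2"
    by (cases w) (simp only: g_apply h_eq[OF s, of p], simp add: A s)
  then show "2 * g (s, p) (0, push p (A s (pull p (snd z)))) w =
      dir_deriv (\<lambda>y. g y (1, 0) w) (s, p) z + dir_deriv (\<lambda>y. g y z w) (s, p) (1, 0)
      - dir_deriv (\<lambda>y. g y z (1, 0)) (s, p) w"
    by (simp add: dir_deriv_g s linear_B linear_K)
qed

text \<open>\<open>E1\<close> and \<open>E2\<close> represent the first two coordinates, which turns
  the last Koszul term into a pairing with \<open>z\<close>. The neutral element suffices as base
  point: these symbols enter the mixed Ricci components undifferentiated. The sign of the time
  component reflects the \<open>-1\<close> in \<open>g\<close>.\<close>

lemma christoffel_space: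
  assumes s: "s \<in> I" and E: "\<And>x. B s E1 x = fst x" "\<And>x. B s E2 x = fst (snd x)"
  shows "christoffel g (s, 0) (a, u) (0, w) = (K s u w / 2,
    a *\<^sub>R A s w + (1 / 2) *\<^sub>R (
      (fst (snd u) * B s Z w + fst (snd w) * B s Z u) *\<^sub>R E1
      - (fst u * B s Z w + fst w * B s Z u) *\<^sub>R E2
      - (fst u * fst (snd w) + fst w * fst (snd u)) *\<^sub>R Z))"
    (is "_ = ?\<Gamma>")
proof (rule christoffel_eqI[where g = g and x = "(s, 0)", OF bilinear_g[OF s] nondegenerate_g[OF s]])
  fix z :: "real \<times> heis"
  obtain b v where z: "z = (b, v)"
    by (cases z)
  show "2 * g (s, 0) ?\<Gamma> z =
      dir_deriv (\<lambda>y. g y (0, w) z) (s, 0) (a, u) + dir_deriv (\<lambda>y. g y (a, u) z) (s, 0) (0, w)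
      - dir_deriv (\<lambda>y. g y (a, u) (0, w)) (s, 0) z"
    unfolding dir_deriv_g[OF s] z g_apply
    by (simp add: s linear_B E A algebra_simps del: scaleR_Pair)
qed

text \<open>The time coefficient \<open>D\<close> can stay unspecified: in the mixed Ricci
  components the time derivative occurs only through its time component, which is zero.\<close>

lemma has_derivative_christoffel_time:
  assumes s: "s \<in> I"
  shows "\<exists>D. ((\<lambda>y. christoffel g y z (1, 0)) has_derivative
    (\<lambda>d. (0, fst d *\<^sub>R D + fst (snd d) *\<^sub>R
      (fst (snd (A s (snd z))) *\<^sub>R Z - fst (snd (snd z)) *\<^sub>R A s Z)))) (at (s, 0))"
proof -
  obtain a u where z: "z = (a, u)"
    by (cases z)
  define D where "D v = vector_derivative (\<lambda>s. A s v) (at s)" for v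
  have dA: "((\<lambda>y. A (fst y) v) has_derivative (\<lambda>d. fst d *\<^sub>R D v)) (at (s, 0 :: heis))" for v
  proof -
    have "((\<lambda>s. A s v) has_derivative (\<lambda>d. d *\<^sub>R D v)) (at (fst (s, 0 :: heis)))"
      using A_differentiable[OF s, of v]
      by (simp add: vector_derivative_works D_def has_vector_derivative_def)
    from has_derivative_compose[OF has_derivative_fst[OF has_derivative_ident] this]
    show ?thesis
      by simp
  qed
  define f where "f y = (0 :: real, A (fst y) u - (fst (snd y) * fst (snd u)) *\<^sub>R A (fst y) Z
      + (fst (snd y) * (fst (snd (A (fst y) u)) - fst (snd y) * fst (snd u) * fst (snd (A (fst y) Z)))) *\<^sub>R Z)"
    for y :: "real \<times> heis"
  have f: "christoffel g y z (1, 0) = f y" if y_in: "y \<in> I \<times> UNIV" for y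
  proof -
    obtain t q where y: "y = (t, q)" "t \<in> I"
      using y_in by (metis mem_Times_iff prod.collapse)
    then show ?thesis
      using linear_A[OF y(2)]
      by (simp add: z christoffel_time f_def pull_def push_def linear_diff linear_scale del: scaleR_Pair)
  qed
  have "(f has_derivative (\<lambda>d. (0, fst d *\<^sub>R D u + fst (snd d) *\<^sub>R
      (fst (snd (A s u)) *\<^sub>R Z - fst (snd u) *\<^sub>R A s Z)))) (at (s, 0))"
    unfolding f_def
    by (rule derivative_eq_intros dA refl)+ (simp add: fun_eq_iff algebra_simps del: scaleR_Pair)
  then show ?thesis
    unfolding z snd_conv
    by (intro exI[of _ "D u"], rule has_derivative_transform_within_open[where s = "I \<times> UNIV"])
      (use s open_I f in \<open>auto simp: open_Times z\<close>)
qed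

section \<open>Mixed Ricci curvature and the Einstein condition\<close>

text \<open>As \<open>[v, u]\<close> is \<open>fst v * fst (snd u) - fst (snd v) * fst u\<close>
  times \<open>Z\<close>, the right-hand side is the trace of \<open>A \<circ> ad v\<close>. The
  derivative terms give its second summand. The trace of \<open>\<Gamma>(\<cdot>, A v)\<close>
  vanishes, and that of \<open>\<Gamma>(v, A \<cdot>)\<close>, entering with a minus sign, gives the
  first summand.\<close>

lemma ricci_mixed:
  assumes s: "s \<in> I"
  shows "ricci g (s, 0) (0, v) (1, 0) = fst v * fst (snd (A s Z)) - fst (snd v) * fst (A s Z)"
proof -
  have "\<exists>w. \<forall>z. B s w z = f z" if "linear f" for f
    using nondegenerate_represents[OF bilinear_h[OF s, of 0] nondegenerate_h[OF s, of 0] that] .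
  moreover have "linear (fst :: heis \<Rightarrow> real)" "linear (\<lambda>z :: heis. fst (snd z))"
    by (auto intro!: linearI)
  ultimately obtain E1 E2 where E: "\<And>x. B s E1 x = fst x" "\<And>x. B s E2 x = fst (snd x)"
    by meson
  let ?e1 = "(1, 0, 0) :: heis" and ?e2 = "(0, 1, 0) :: heis"
  have D: "dir_deriv (\<lambda>y. christoffel g y z (1, 0)) (s, 0) (0, q) =
      (0, fst q *\<^sub>R (fst (snd (A s (snd z))) *\<^sub>R Z - fst (snd (snd z)) *\<^sub>R A s Z))"
    and D0: "fst (dir_deriv (\<lambda>y. christoffel g y z (1, 0)) (s, 0) (1, 0)) = 0" for z q
    using has_derivative_christoffel_time[OF s, of z] by (auto simp: frechet_derivative_at[symmetric] zero_prod_def)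
  have A0: "A s 0 = 0"
    using linear_A[OF s] by (rule linear_0)
  have comb: "x = fst x *\<^sub>R ?e1 + fst (snd x) *\<^sub>R ?e2 + snd (snd x) *\<^sub>R Z" for x :: heis
    by (cases x) simp
  have BZ: "B s Z x = fst x * B s Z ?e1 + fst (snd x) * B s Z ?e2 + snd (snd x) * B s Z Z" for x
    by (subst comb[of x]) (simp only: linear_B[OF s])
  have As: "A s x = fst x *\<^sub>R A s ?e1 + fst (snd x) *\<^sub>R A s ?e2 + snd (snd x) *\<^sub>R A s Z" for x
    by (subst comb[of x]) (simp only: linear_add[OF linear_A[OF s]] linear_scale[OF linear_A[OF s]])
  have selfadj: "B s (A s u) v = B s u (A s v)" for u v
    using A[OF s, of u v] A[OF s, of v u] K_sym[OF s, of u v] sym_h[OF s, of 0 u "A s v"] by simp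
  have Z_E: "B s Z E1 = 0" "B s Z E2 = 0"
    using E sym_h[OF s, of 0 Z] by simp_all
  have Z_AE: "B s Z (A s E1) = fst (A s Z)" "B s Z (A s E2) = fst (snd (A s Z))"
    using E sym_h[OF s, of 0 "A s Z"] selfadj[of Z, symmetric] by simp_all
  have E12: "fst (snd E1) = fst E2" "fst (A s E2) = fst (snd (A s E1))"
    using E sym_h[OF s, of 0 E1 E2] selfadj[of E1 E2] sym_h[OF s, of 0 "A s E1" E2] by simp_all
  have inner: "x \<bullet> (1, 0) = fst x" "x \<bullet> (0, 1, 0, 0) = fst (snd x)"
    "x \<bullet> (0, 0, 1, 0) = fst (snd (snd x))" "x \<bullet> (0, 0, 0, 1) = snd (snd (snd x))"
    for x :: "real \<times> heis"
    by (cases x; simp)+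
  \<comment> \<open>Orthogonality of \<open>Z\<close> to \<open>E1\<close> and \<open>E2\<close>,
    and self-adjointness of \<open>A\<close>, are written out in coordinates to match the traces
    over the standard basis.\<close>
  note rel = Z_E[unfolded BZ[of E1] BZ[of E2]]
    Z_AE[unfolded As[of E1] As[of E2] linear_B[OF s] BZ[of "A s _"]]
    E12(2)[unfolded As[of E1] As[of E2]]
  \<comment> \<open>The traces of \<open>\<Gamma>(\<cdot>, A v)\<close> and \<open>\<Gamma>(v, A \<cdot>)\<close> are linear combinations of these multiples.\<close>
  note rel' = arg_cong[OF rel(1), of "(*) (fst (snd (A s v)))"]
    arg_cong[OF rel(2), of "(*) (fst (A s v))"]
    arg_cong[OF rel(3), of "(*) (fst (snd v))"]
    arg_cong[OF rel(4), of "(*) (fst v)"]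
    arg_cong[OF rel(5), of "(*) (fst v * B s Z ?e1 + fst (snd v) * B s Z ?e2 + snd (snd v) * B s Z Z)"]
  show ?thesis
    unfolding ricci_eq_sum_christoffel sum_Basis_real4 inner
    using rel'
    by (simp add: D D0 E12(1) christoffel_time[OF s] christoffel_space[OF s E] A0 linear_B[OF s]
        linear_K[OF s] BZ[of "A s _"] BZ[of v] field_simps)
qed

lemma einstein_center_eigenvector:
  assumes "einstein_metric (I \<times> UNIV) g" and s: "s \<in> I"
  shows "A s Z = snd (snd (A s Z)) *\<^sub>R Z"
proof -
  obtain \<Lambda> where "\<And>y u v. y \<in> I \<times> UNIV \<Longrightarrow> ricci g y u v = \<Lambda> * g y u v"
    using assms(1) unfolding einstein_metric_def by blast
  then have einstein: "ricci g (s, 0) (0, v) (1, 0) = \<Lambda> * g (s, 0) (0, v) (1, 0)" for v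
    using s by blast
  have ric: "fst v * fst (snd (A s Z)) - fst (snd v) * fst (A s Z) = 0" for v :: heis
    using einstein[of v] ricci_mixed[OF s, of v] s by (simp add: g_apply linear_B)
  \<comment> \<open>The mixed components vanish because time and orbit directions are orthogonal;
    the two coordinate vectors transverse to the centre isolate the two unwanted components of
    \<open>A s Z\<close>.\<close>
  have "fst (A s Z) = 0" "fst (snd (A s Z)) = 0"
    using ric[of "(0, 1, 0)"] ric[of "(1, 0, 0)"] by simp_all
  then show ?thesis
    by (cases "A s Z") auto
qed

lemma einstein_center_parallel:
  assumes I: "is_interval I" "s \<in> I" "t \<in> I" and einstein: "einstein_metric (I \<times> UNIV) g"
  shows "\<exists>k>0. B t Z Z = k * B s Z Z"
proof -
  \<comment> \<open>\<open>X\<close> is the covector \<chi>(Z, .) as a coordinate vector; its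
    component along \<open>Z\<close> is \<chi>(Z, Z). The 2 in \<open>c\<close> undoes the factor
    1/2 in \<open>A\<close>.\<close>
  define X where "X \<tau> = (\<Sum>b\<in>Basis. B \<tau> Z b *\<^sub>R b)" for \<tau>
  define c where "c \<tau> = 2 * snd (snd (A \<tau> Z))" for \<tau>
  have X_Z: "X \<tau> \<bullet> Z = B \<tau> Z Z" if "\<tau> \<in> I" for \<tau>
    by (simp add: X_def Basis_prod_def inner_sum_left)
  have "\<exists>k>0. X t = k *\<^sub>R X s"
  proof (rule interval_parallel_derivative[OF I])
    fix \<tau> assume \<tau>: "\<tau> \<in> I"
    have K: "K \<tau> Z z = c \<tau> * B \<tau> Z z" for z
      using A[OF \<tau>, of Z z] einstein_center_eigenvector[OF einstein \<tau>]
        linear_B(2)[OF \<tau>, of "snd (snd (A \<tau> Z))" Z z]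
      by (simp add: c_def)
    have "(X has_vector_derivative (\<Sum>b\<in>Basis. K \<tau> Z b *\<^sub>R b)) (at \<tau>)"
      unfolding X_def
      by (auto intro!: derivative_eq_intros h_smooth(1)[OF \<tau>])
    then show "(X has_vector_derivative c \<tau> *\<^sub>R X \<tau>) (at \<tau>)"
      by (simp add: K X_def scaleR_sum_right)
    show "X \<tau> \<noteq> 0"
    proof
      assume 0: "X \<tau> = 0"
      have "B \<tau> Z b = 0" if "b \<in> Basis" for b
        using arg_cong[OF 0, of "\<lambda>x. x \<bullet> b"] that by (simp add: X_def)
      then have "B \<tau> Z = (\<lambda>_. 0)"
        using linear_B(3,4)[OF \<tau>]
        by (intro linear_eq_stdbasis) (auto intro!: linearI)
      then have "Z = 0"
        using nondegenerate_h[OF \<tau>, of 0] unfolding nondegenerate_def by metis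
      then show False
        by (simp add: zero_prod_def)
    qed
  qed
  then show ?thesis
    using I X_Z by (metis inner_scaleR_left)
qed

end

section \<open>Causal character of the centre\<close>

lemma causal_character_center:
  assumes "bilinear b"
  shows "timelike b heis_center \<longleftrightarrow> b Z Z < 0"
    and "spacelike b heis_center \<longleftrightarrow> b Z Z > 0"
    and "lightlike b heis_center \<longleftrightarrow> b Z Z = 0"
proof -
  have center: "heis_center - {0} = (\<lambda>c. c *\<^sub>R Z) ` {c. c \<noteq> 0}"
    by (auto simp: heis_center_eq span_singleton zero_prod_def)
  have b: "b (c *\<^sub>R Z) (c *\<^sub>R Z) = c\<^sup>2 * b Z Z" for c
    using assms by (simp only: bilinear_lmul bilinear_rmul) (simp add: power2_eq_square)
  \<comment> \<open>A nonzero multiple of \<open>Z\<close> must exist for the quantifier over the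
    punctured line not to be vacuous.\<close>
  have one: "\<exists>c::real. c \<noteq> 0"
    by (rule exI[of _ 1]) simp
  show "timelike b heis_center \<longleftrightarrow> b Z Z < 0" "spacelike b heis_center \<longleftrightarrow> b Z Z > 0"
    "lightlike b heis_center \<longleftrightarrow> b Z Z = 0"
    unfolding timelike_def spacelike_def lightlike_def center ball_simps b
    using one by (auto simp: mult_less_0_iff zero_less_mult_iff)
qed

theorem proposition2p4:
  fixes I :: "real set" and \<epsilon> :: real and h :: "real \<Rightarrow> heis metric_tensor" and t0 :: real
  assumes "neutral_heisenberg_manifold I \<epsilon> h"
    and "einstein_metric (I \<times> UNIV) (heisenberg_metric \<epsilon> h)"
    and "t0 \<in> I"
  shows "(timelike (h t0 0) heis_center \<longrightarrow> (\<forall>t\<in>I. timelike (h t 0) heis_center)) \<and>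
    (spacelike (h t0 0) heis_center \<longrightarrow> (\<forall>t\<in>I. spacelike (h t 0) heis_center)) \<and>
    (lightlike (h t0 0) heis_center \<longrightarrow> (\<forall>t\<in>I. lightlike (h t 0) heis_center))"
proof -
  interpret left_invariant_family I h
    using assms(1) by unfold_locales (auto simp: neutral_heisenberg_manifold_def)
  have "\<exists>k>0. h t 0 Z Z = k * h t0 0 Z Z" if "t \<in> I" for t
    using einstein_center_parallel[of t0 t] assms that by (auto simp: neutral_heisenberg_manifold_def)
  then show ?thesis
    using assms(3) bilinear_h
    by (simp add: causal_character_center) (metis mult_pos_neg mult_pos_pos mult_zero_right)
qed

end
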